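(* Let $p$ be a prime or a prime power and let $r,k$ be positive integers with $r<k\leq p$. Suppose there is a $k\times k$ (complex) unitary matrix $U=(u_{i,j})$ such that $\alpha=\max_{i,j}|u_{i,j}|$ satisfies $r\alpha^{2}<1$. Then there exists a complex matrix of size $pk\times (pk\cdot p^{r})$ which is a union of $p^{r}$ orthonormal bases of $\mathbb{C}^{pk}$, whose coherence is at most $r\alpha^{2}$, and whose density is $\frac{1}{p}$.
   Context: A matrix is a union of $Q$ orthonormal bases of $\mathbb{C}^{n}$ if it is of size $n\times nQ$ and is the column-wise concatenation of $Q$ unitary $n\times n$ matrices. The coherence of a matrix $\Phi$ with nonzero columns $\phi_1,\dots,\phi_M$ is $\mu_\Phi=\max_{i\ne j}\frac{|\langle \phi_i,\phi_j\rangle|}{\|\phi_i\|_2\|\phi_j\|_2}$, with $\langle\cdot,\cdot\rangle$ the standard Hermitian inner product. The density of a matrix is the ratio of the number of its nonzero entries to the total number of its entries. *)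

theory Defs
  imports Complex_Main
    "HOL-Number_Theory.Prime_Powers"
    "Jordan_Normal_Form.Schur_Decomposition"
begin

definition unitary_mat :: "nat \<Rightarrow> complex mat \<Rightarrow> bool" where
  "unitary_mat n A \<longleftrightarrow> A \<in> carrier_mat n n \<and>
     A * mat_adjoint A = 1\<^sub>m n \<and> mat_adjoint A * A = 1\<^sub>m n"

definition union_of_orthonormal_bases :: "nat \<Rightarrow> nat \<Rightarrow> complex mat \<Rightarrow> bool" where
  "union_of_orthonormal_bases n Q A \<longleftrightarrow> A \<in> carrier_mat n (n * Q) \<and>
     (\<exists>Bs. length Bs = Q \<and> (\<forall>B \<in> set Bs. unitary_mat n B) \<and>
           A = mat_of_cols n (concat (map cols Bs)))"

definition l2_norm_vec :: "complex vec \<Rightarrow> real" where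
  "l2_norm_vec v = sqrt (\<Sum>i<dim_vec v. (cmod (v $ i))\<^sup>2)"

(* Meaningful for matrices with at least two columns (so that Max is taken over a
   nonempty set), all of them nonzero. *)
definition coherence :: "complex mat \<Rightarrow> real" where
  "coherence A = Max {cmod (col A i \<bullet>c col A j) / (l2_norm_vec (col A i) * l2_norm_vec (col A j))
                      | i j. i < dim_col A \<and> j < dim_col A \<and> i \<noteq> j}"

definition matrix_density :: "complex mat \<Rightarrow> real" where
  "matrix_density A =
     real (card {(i, j). i < dim_row A \<and> j < dim_col A \<and> A $$ (i, j) \<noteq> 0})
     / real (dim_row A * dim_col A)"

end

(*
  A zero entry of U would lower the density of a direct construction from U. But some row of U has
  k entries of total squared modulus 1, so alpha^2 >= 1/k, and the k x k Fourier matrix, all of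
  whose entries have modulus 1/sqrt k, may replace U. Over the field with p elements take k points
  and all polynomials f of degree at most r; for each f and each column of the Fourier matrix,
  place that column on the graph of f. Columns for the same f are orthogonal, graphs of distinct
  polynomials meet in at most r points, and polynomials that differ by a constant have disjoint
  graphs, so they give an orthonormal basis.
*)
theory Submission
  imports Defs "HOL-Number_Theory.Cong" "HOL-Library.FuncSet"
begin

section \<open>Prime ideals and finite fields\<close>

text \<open>Congruence modulo \<open>I\<close> is written \<open>x - y \<in> I\<close>, so residue
  rings are handled through representatives and no quotient type is formed.\<close>

locale ring_ideal =
  fixes I :: "'a::comm_ring_1 set"
  assumes zero_mem: "0 \<in> I"
    and add_mem: "x \<in> I \<Longrightarrow> y \<in> I \<Longrightarrow> x + y \<in> I"
    and mult_mem: "x \<in> I \<Longrightarrow> a * x \<in> I"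
begin

lemma mult_mem_right: "x \<in> I \<Longrightarrow> x * a \<in> I"
  using mult_mem[of x a] by (simp add: mult.commute)

lemma uminus_mem: "x \<in> I \<Longrightarrow> - x \<in> I"
  using mult_mem[of x "-1"] by simp

lemma diff_mem: "x \<in> I \<Longrightarrow> y \<in> I \<Longrightarrow> x - y \<in> I"
  using add_mem[of x "- y"] uminus_mem[of y] by simp

lemma diff_mem_sym: "x - y \<in> I \<Longrightarrow> y - x \<in> I"
  using uminus_mem[of "x - y"] by simp

lemma diff_mem_trans: "x - y \<in> I \<Longrightarrow> y - z \<in> I \<Longrightarrow> x - z \<in> I"
  using add_mem[of "x - y" "y - z"] by simp

lemma sum_mem: "(\<And>i. i \<in> S \<Longrightarrow> f i \<in> I) \<Longrightarrow> sum f S \<in> I"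
  by (induction S rule: infinite_finite_induct) (auto intro: zero_mem add_mem)

lemma mult_cong_mem:
  assumes "a - b \<in> I" "c - d \<in> I"
  shows "a * c - b * d \<in> I"
proof -
  have "a * c - b * d = c * (a - b) + b * (c - d)"
    by (simp add: algebra_simps)
  then show ?thesis
    using assms by (simp add: add_mem mult_mem)
qed

lemma add_cong_mem:
  assumes "a - b \<in> I" "c - d \<in> I"
  shows "(a + c) - (b + d) \<in> I"
  using add_mem[OF assms] by (simp add: algebra_simps)

lemma power_cong_mem:
  assumes "a - b \<in> I"
  shows "a ^ n - b ^ n \<in> I"
  by (induction n) (auto simp: zero_mem intro: mult_cong_mem assms)

end

locale proper_prime_ideal = ring_ideal +
  assumes one_notin: "1 \<notin> I"
    and prime_mem: "x * y \<in> I \<Longrightarrow> x \<in> I \<or> y \<in> I"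
begin

text \<open>Modulo a prime ideal the ring is an integral domain, where a nonzero polynomial has at
  most as many roots as its degree. Roots are split off one at a time by synthetic division.\<close>

lemma coeff_mem_if_many_roots:
  assumes "finite S" "degree f < card S"
    and "\<And>x. x \<in> S \<Longrightarrow> poly f x \<in> I"
    and "\<And>x y. x \<in> S \<Longrightarrow> y \<in> S \<Longrightarrow> x - y \<in> I \<Longrightarrow> x = y"
  shows "coeff f i \<in> I"
  using assms
proof (induction S arbitrary: f i rule: finite_induct)
  case empty
  then show ?case by simp
next
  case (insert c S)
  define g where "g = synthetic_div f c"
  have f_eq: "f = [:- c, 1:] * g + [:poly f c:]"
    unfolding g_def by (rule synthetic_div_correct'[symmetric])
  have root_c: "poly f c \<in> I"
    using insert.prems(2) by simp
  have g_mem: "coeff g j \<in> I" for j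
  proof (cases "degree f = 0")
    case True
    then have "g = 0"
      by (simp add: g_def synthetic_div_eq_0_iff)
    then show ?thesis
      by (simp add: zero_mem)
  next
    case False
    have deg: "degree g < card S"
      using insert.prems(1) insert.hyps False by (simp add: g_def degree_synthetic_div)
    have "poly g x \<in> I" if "x \<in> S" for x
    proof -
      have "poly f x = (x - c) * poly g x + poly f c"
        by (subst f_eq) (simp add: algebra_simps)
      then have "(x - c) * poly g x = poly f x - poly f c"
        by simp
      then have "(x - c) * poly g x \<in> I"
        using insert.prems(2)[of x] root_c that by (simp add: diff_mem)
      \<comment> \<open>\<open>x\<close> and \<open>c\<close> are different residues, so primality
        cancels the factor \<open>x - c\<close>.\<close>
      moreover have "x - c \<notin> I"
        using insert.prems(3)[of x c] insert.hyps that by auto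
      ultimately show ?thesis
        using prime_mem by blast
    qed
    then show ?thesis
      using insert.IH[OF deg] insert.prems(3) by blast
  qed
  have "f = pCons (poly f c) g - smult c g"
    by (subst f_eq) (simp add: algebra_simps)
  then have "coeff f i = coeff (pCons (poly f c) g) i - c * coeff g i"
    by (metis coeff_diff coeff_smult)
  moreover have "coeff (pCons (poly f c) g) i \<in> I"
    by (cases i) (auto simp: root_c g_mem)
  ultimately show ?case
    by (simp add: diff_mem mult_mem g_mem)
qed

end

text \<open>Zorn's lemma yields an ideal maximal among those that contain \<open>I\<close> but not
  1; such an ideal is prime.\<close>

lemma exists_proper_prime_ideal:
  fixes I :: "'a::comm_ring_1 set"
  assumes "ring_ideal I" "1 \<notin> I"
  shows "\<exists>M. proper_prime_ideal M \<and> I \<subseteq> M"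
proof -
  define \<A> where "\<A> = {J. ring_ideal J \<and> 1 \<notin> J \<and> I \<subseteq> J}"
  have "I \<in> \<A>"
    using assms by (simp add: \<A>_def)
  have "\<exists>M\<in>\<A>. \<forall>X\<in>\<A>. M \<subseteq> X \<longrightarrow> X = M"
  proof (rule subset_Zorn_nonempty)
    show "\<A> \<noteq> {}"
      using \<open>I \<in> \<A>\<close> by blast
  next
    fix \<C> assume ne: "\<C> \<noteq> {}" and chain: "subset.chain \<A> \<C>"
    have \<C>: "ring_ideal J" "1 \<notin> J" "I \<subseteq> J" if "J \<in> \<C>" for J
      using chain that unfolding subset_chain_def \<A>_def by auto
    have total: "J \<subseteq> K \<or> K \<subseteq> J" if "J \<in> \<C>" "K \<in> \<C>" for J K
      using chain that unfolding subset_chain_def by blast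
    have "ring_ideal (\<Union>\<C>)"
    proof
      show "0 \<in> \<Union>\<C>"
        using ne \<C>(1) ring_ideal.zero_mem by blast
    next
      fix x y assume "x \<in> \<Union>\<C>" "y \<in> \<Union>\<C>"
      then obtain J where "J \<in> \<C>" "x \<in> J" "y \<in> J"
        using total by blast
      then show "x + y \<in> \<Union>\<C>"
        using \<C>(1) ring_ideal.add_mem by blast
    next
      fix x a assume "x \<in> \<Union>\<C>"
      then show "a * x \<in> \<Union>\<C>"
        using \<C>(1) ring_ideal.mult_mem by blast
    qed
    then show "\<Union>\<C> \<in> \<A>"
      unfolding \<A>_def using \<C>(2,3) ne by blast
  qed
  then obtain M where "M \<in> \<A>" and maximal: "\<And>X. X \<in> \<A> \<Longrightarrow> M \<subseteq> X \<Longrightarrow> X = M"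
    by blast
  then have M: "ring_ideal M" "1 \<notin> M" "I \<subseteq> M"
    by (auto simp: \<A>_def)
  interpret M: ring_ideal M by fact
  have "proper_prime_ideal M"
  proof
    show "1 \<notin> M" by fact
  next
    fix x y assume xy: "x * y \<in> M"
    show "x \<in> M \<or> y \<in> M"
    proof (rule ccontr)
      assume "\<not> (x \<in> M \<or> y \<in> M)"
      then have x: "x \<notin> M" and y: "y \<notin> M" by auto
      \<comment> \<open>The ideal generated by \<open>M\<close> and \<open>x\<close>. It is strictly
        larger than \<open>M\<close>, so by maximality it contains 1.\<close>
      define J where "J = {u + a * x | u a. u \<in> M}"
      have "ring_ideal J"
      proof
        show "0 \<in> J"
          unfolding J_def using M.zero_mem by (auto intro!: exI[of _ 0])
      next
        fix s t assume "s \<in> J" "t \<in> J"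
        then obtain u a v b where "s = u + a * x" "t = v + b * x" "u \<in> M" "v \<in> M"
          unfolding J_def by blast
        then have "s + t = (u + v) + (a + b) * x" "u + v \<in> M"
          by (auto simp: algebra_simps M.add_mem)
        then show "s + t \<in> J"
          unfolding J_def by blast
      next
        fix s c assume "s \<in> J"
        then obtain u a where "s = u + a * x" "u \<in> M"
          unfolding J_def by blast
        then have "c * s = c * u + (c * a) * x" "c * u \<in> M"
          by (auto simp: algebra_simps M.mult_mem)
        then show "c * s \<in> J"
          unfolding J_def by blast
      qed
      moreover have "M \<subseteq> J"
      proof
        fix u assume "u \<in> M"
        moreover have "u = u + 0 * x" by simp
        ultimately show "u \<in> J"
          unfolding J_def by blast
      qed
      moreover have "x \<in> J"
      proof -
        have "x = 0 + 1 * x" by simp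
        then show ?thesis
          unfolding J_def using M.zero_mem by blast
      qed
      ultimately have "1 \<in> J"
        using maximal[of J] x M(3) unfolding \<A>_def by blast
      then obtain u a where "1 = u + a * x" and u: "u \<in> M"
        unfolding J_def by blast
      \<comment> \<open>Both summands lie in \<open>M\<close>: the first because of
        \<open>u\<close>, the second because of \<open>x * y\<close>.\<close>
      then have "y = y * u + a * (x * y)"
        by (metis mult.commute mult.left_commute mult.right_neutral distrib_left)
      then have "y \<in> M"
        using u xy by (metis M.add_mem M.mult_mem)
      then show False using y by simp
    qed
  qed
  then show ?thesis
    using M(3) by blast
qed

section \<open>The ring Z[z] for a root of unity z\<close>

text \<open>Integer polynomials represent the elements of Z[z], so the type \<open>int poly\<close>
  can serve as the ambient ring; equality in Z[z] is equality of values at \<open>z\<close>.\<close>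

definition int_eval :: "complex \<Rightarrow> int poly \<Rightarrow> complex" where
  "int_eval z f = poly (map_poly of_int f) z"

lemma int_eval_simps [simp]:
  "int_eval z 0 = 0"
  "int_eval z 1 = 1"
  "int_eval z (f + g) = int_eval z f + int_eval z g"
  "int_eval z (f - g) = int_eval z f - int_eval z g"
  "int_eval z (f * g) = int_eval z f * int_eval z g"
  "int_eval z (f ^ n) = int_eval z f ^ n"
  "int_eval z (pCons c f) = of_int c + z * int_eval z f"
  "int_eval z (of_nat n) = of_nat n"
  by (simp_all add: int_eval_def hom_distribs)

lemma int_eval_sum [simp]: "int_eval z (sum f S) = (\<Sum>i\<in>S. int_eval z (f i))"
  by (induction S rule: infinite_finite_induct) auto

text \<open>Horner induction: multiplying by \<open>z\<close> shifts the \<open>m\<close>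
  coefficients cyclically, because \<open>z ^ m = 1\<close>.\<close>

lemma int_eval_root_of_unity_reduce:
  fixes z :: complex
  assumes "z ^ m = 1" "m > 0"
  shows "\<exists>a. int_eval z f = (\<Sum>j<m. of_int (a j) * z ^ j)"
proof (induction f)
  case 0
  show ?case by (intro exI[of _ "\<lambda>_. 0"]) simp
next
  case (pCons c f)
  then obtain a where a: "int_eval z f = (\<Sum>j<m. of_int (a j) * z ^ j)"
    by blast
  obtain n where m: "m = Suc n"
    using assms(2) gr0_implies_Suc by blast
  \<comment> \<open>The top coefficient \<open>a n\<close> wraps around to the constant term, where
    \<open>c\<close> is added.\<close>
  define b where "b j = (if j = 0 then c + a n else a (j - 1))" for j
  have "int_eval z (pCons c f) = of_int c + (\<Sum>j<m. of_int (a j) * z ^ Suc j)"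
    by (simp add: a sum_distrib_left mult_ac)
  also have "\<dots> = of_int (c + a n) + (\<Sum>j<n. of_int (a j) * z ^ Suc j)"
    using assms(1) by (simp add: m)
  also have "\<dots> = (\<Sum>j<m. of_int (b j) * z ^ j)"
    unfolding m sum.lessThan_Suc_shift by (simp add: b_def)
  finally show ?case by blast
qed

text \<open>By the Leibniz formula the determinant is an integer polynomial in the entries.\<close>

lemma det_cong_int:
  fixes A B :: "int mat"
  assumes "A \<in> carrier_mat n n" "B \<in> carrier_mat n n"
    and "\<And>i j. i < n \<Longrightarrow> j < n \<Longrightarrow> [A $$ (i, j) = B $$ (i, j)] (mod d)"
  shows "[det A = det B] (mod d)"
  unfolding det_def'[OF assms(1)] det_def'[OF assms(2)]
proof (intro cong_sum cong_mult cong_prod cong_refl)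
  fix \<pi> i assume "\<pi> \<in> {\<pi>. \<pi> permutes {0..<n}}" "i \<in> {0..<n}"
  then show "[A $$ (i, \<pi> i) = B $$ (i, \<pi> i)] (mod d)"
    using permutes_in_image[of \<pi> "{0..<n}" i] by (intro assms(3)) auto
qed

text \<open>If \<open>p g(z) = 1\<close>, then multiplication by \<open>g(z)\<close> on the powers of \<open>z\<close> is given by an
  integer matrix \<open>A\<close> with \<open>det (1 - p A) = 0\<close>, whereas \<open>det (1 - p A)\<close> is congruent to 1
  modulo \<open>p\<close>.\<close>

lemma nat_not_unit_in_cyclotomic_ring:
  fixes z :: complex
  assumes "z ^ m = 1" "m > 0" "p > 1"
  shows "of_nat p * int_eval z g \<noteq> 1"
proof
  assume unit: "of_nat p * int_eval z g = 1"
  \<comment> \<open>Row \<open>i\<close> of the matrix A expands \<open>z ^ i * g(z)\<close> in the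
    powers of \<open>z\<close>.\<close>
  have "\<forall>i. \<exists>a. int_eval z (monom 1 i * g) = (\<Sum>j<m. of_int (a j) * z ^ j)"
    using int_eval_root_of_unity_reduce[OF assms(1,2)] by blast
  then obtain a where a: "\<And>i. int_eval z (monom 1 i * g) = (\<Sum>j<m. of_int (a i j) * z ^ j)"
    by metis
  define B where "B = mat m m (\<lambda>(i, j). (if i = j then 1 else 0) - int p * a i j)"
  have B: "B \<in> carrier_mat m m" by (simp add: B_def)
  define v where "v = vec m (\<lambda>j. z ^ j)"
  have "map_mat complex_of_int B *\<^sub>v v = 0\<^sub>v m"
  proof (rule eq_vecI)
    fix i assume "i < dim_vec (0\<^sub>v m :: complex vec)"
    then have i: "i < m" by simp
    have "(map_mat complex_of_int B *\<^sub>v v) $ i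
        = (\<Sum>j<m. ((if i = j then 1 else 0) - of_nat p * of_int (a i j)) * z ^ j)"
      using i unfolding B_def v_def
      by (simp add: scalar_prod_def lessThan_atLeast0 of_int_diff cong: sum.cong)
         (intro sum.cong, auto)
    also have "\<dots> = (\<Sum>j<m. if i = j then z ^ j else 0)
        - of_nat p * (\<Sum>j<m. of_int (a i j) * z ^ j)"
      unfolding sum_distrib_left sum_subtractf[symmetric]
      by (intro sum.cong) (auto simp: algebra_simps)
    also have "\<dots> = z ^ i - of_nat p * int_eval z (monom 1 i * g)"
      using i by (simp add: a[symmetric] del: int_eval_simps)
    also have "int_eval z (monom 1 i * g) = z ^ i * int_eval z g"
      by (simp add: int_eval_def hom_distribs poly_monom)
    also have "z ^ i - of_nat p * (z ^ i * int_eval z g) = z ^ i * (1 - of_nat p * int_eval z g)"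
      by (simp add: algebra_simps)
    also have "\<dots> = 0"
      using unit by simp
    finally show "(map_mat complex_of_int B *\<^sub>v v) $ i = 0\<^sub>v m $ i"
      using i by simp
  qed (simp add: B_def)
  moreover have "v \<in> carrier_vec m" by (simp add: v_def)
  \<comment> \<open>Entry 0 of \<open>v\<close> is \<open>z ^ 0 = 1\<close>, so \<open>v\<close> is
    a nonzero kernel vector.\<close>
  moreover have "v $ 0 \<noteq> 0\<^sub>v m $ 0"
    using assms(2) by (simp add: v_def)
  then have "v \<noteq> 0\<^sub>v m" by metis
  ultimately have "det (map_mat complex_of_int B) = 0"
    using det_0_iff_vec_prod_zero[of "map_mat complex_of_int B" m] B by auto
  then have "det B = 0"
    by (simp add: of_int_hom.hom_det)
  moreover have "[det B = det (1\<^sub>m m)] (mod int p)"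
    by (rule det_cong_int[OF B]) (auto simp: B_def cong_iff_dvd_diff)
  ultimately show False
    using assms(3) by (auto simp: cong_def)
qed

section \<open>Frobenius map and residue fields of prime power order\<close>

text \<open>The inner binomial coefficients of exponent \<open>p\<close> are divisible by
  \<open>p\<close>; iterating the case of exponent \<open>p\<close> gives the powers
  \<open>p ^ n\<close>.\<close>

lemma (in ring_ideal) add_power_prime_power_mem:
  assumes "prime p" "of_nat p \<in> I"
  shows "(f + g) ^ (p ^ n) - (f ^ (p ^ n) + g ^ (p ^ n)) \<in> I"
proof (induction n)
  case 0
  then show ?case by (simp add: zero_mem)
next
  case (Suc n)
  have prime_case: "(x + y) ^ p - (x ^ p + y ^ p) \<in> I" for x y
  proof -
    obtain d where p: "p = Suc d"
      using assms(1) prime_gt_0_nat gr0_implies_Suc by blast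
    have "(x + y) ^ p = (\<Sum>j\<le>Suc d. of_nat (p choose j) * x ^ j * y ^ (p - j))"
      unfolding binomial_ring by (simp add: p)
    also have "\<dots> = y ^ p + (\<Sum>j<Suc d. of_nat (p choose Suc j) * x ^ Suc j * y ^ (p - Suc j))"
      unfolding sum.atMost_Suc_shift lessThan_Suc_atMost by simp
    also have "\<dots> = x ^ p + y ^ p + (\<Sum>j<d. of_nat (p choose Suc j) * x ^ Suc j * y ^ (p - Suc j))"
      unfolding sum.lessThan_Suc p by (simp del: binomial_Suc_Suc power_Suc)
    finally have "(x + y) ^ p - (x ^ p + y ^ p)
        = (\<Sum>j<d. of_nat (p choose Suc j) * x ^ Suc j * y ^ (p - Suc j))"
      by simp
    also have "\<dots> \<in> I"
    proof (intro sum_mem mult_mem_right)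
      fix j assume "j \<in> {..<d}"
      then have "p dvd (p choose Suc j)"
        using assms(1) p by (intro dvd_choose_prime) auto
      then show "of_nat (p choose Suc j) \<in> I"
        using assms(2) by (auto elim!: dvdE intro: mult_mem_right)
    qed
    finally show ?thesis .
  qed
  have "((f + g) ^ (p ^ n)) ^ p - (f ^ (p ^ n) + g ^ (p ^ n)) ^ p \<in> I"
    by (rule power_cong_mem[OF Suc])
  from diff_mem_trans[OF this prime_case] show ?case
    by (simp add: power_mult[symmetric] mult.commute)
qed

text \<open>A field with \<open>p ^ n\<close> elements arises from the ring of integers of the cyclotomic field of
  order \<open>m = p ^ n - 1\<close> modulo a prime above \<open>p\<close>. There \<open>\<zeta>\<close> keeps its order \<open>m\<close>, since
  \<open>\<zeta> ^ i - 1\<close> divides \<open>m\<close>, which is prime to \<open>p\<close>; and every residue is a root of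
  \<open>Y ^ (p ^ n) - Y\<close> because this holds for \<open>\<zeta>\<close> and the Frobenius map is additive.\<close>

lemma exists_residue_field_of_prime_power_order:
  fixes p n :: nat
  assumes "prime p" "n > 0"
  shows "\<exists>(M :: int poly set) T. proper_prime_ideal M \<and> finite T \<and> card T = p ^ n \<and>
           (\<forall>x\<in>T. \<forall>y\<in>T. x - y \<in> M \<longrightarrow> x = y) \<and> (\<forall>f. \<exists>t\<in>T. f - t \<in> M)"
proof -
  define q where "q = p ^ n"
  define m where "m = q - 1"
  have "q \<ge> 2"
    using prime_ge_2_nat[OF assms(1)] assms(2) self_le_power[of p n] by (simp add: q_def)
  then have m: "m > 0" "q = Suc m" by (auto simp: m_def)
  define z where "z = cis (2 * pi / real m)"
  have z_power: "z ^ m = 1"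
    using m by (simp add: z_def DeMoivre)
  have z_order: "z ^ i \<noteq> 1" if "0 < i" "i < m" for i
  proof
    assume "z ^ i = 1"
    then have "cis (2 * pi * real i / real m) = cis (2 * pi * real 0 / real m)"
      by (simp add: z_def DeMoivre mult_ac)
    then have "i = 0"
      using bij_betw_imp_inj_on[OF bij_betw_roots_unity[OF m(1)]] that
      by (elim inj_onD) auto
    then show False using that by simp
  qed
  \<comment> \<open>The preimage in \<open>int poly\<close> of the ideal of Z[z] generated by
    \<open>p\<close>; it contains every polynomial that vanishes at \<open>z\<close>.\<close>
  define I where "I = {f. \<exists>g. int_eval z f = of_nat p * int_eval z g}"
  have I_if_root: "f \<in> I" if "int_eval z f = 0" for f
    unfolding I_def using that by (auto intro!: exI[of _ 0])
  have "ring_ideal I"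
  proof
    show "0 \<in> I" by (simp add: I_if_root)
  next
    fix f g assume "f \<in> I" "g \<in> I"
    then obtain f' g' where "int_eval z f = of_nat p * int_eval z f'"
      "int_eval z g = of_nat p * int_eval z g'"
      unfolding I_def by blast
    then have "int_eval z (f + g) = of_nat p * int_eval z (f' + g')"
      by (simp add: algebra_simps)
    then show "f + g \<in> I" unfolding I_def by blast
  next
    fix f g assume "f \<in> I"
    then obtain f' where "int_eval z f = of_nat p * int_eval z f'"
      unfolding I_def by blast
    then have "int_eval z (g * f) = of_nat p * int_eval z (g * f')"
      by (simp add: algebra_simps)
    then show "g * f \<in> I" unfolding I_def by blast
  qed
  \<comment> \<open>Otherwise \<open>p\<close> would be a unit of Z[z].\<close>
  moreover have "1 \<notin> I"
    using nat_not_unit_in_cyclotomic_ring[OF z_power m(1) prime_gt_1_nat[OF assms(1)]]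
    by (auto simp: I_def dest: sym)
  ultimately obtain M where "proper_prime_ideal M" and "I \<subseteq> M"
    using exists_proper_prime_ideal by blast
  interpret M: proper_prime_ideal M by fact
  have p_mem: "of_nat p \<in> M"
    using \<open>I \<subseteq> M\<close> by (auto simp: I_def intro!: exI[of _ 1])
  have m_notin: "of_nat m \<notin> M"
  proof
    assume "of_nat m \<in> M"
    moreover have "of_nat q \<in> M"
    proof -
      have "p dvd q" using assms(2) by (simp add: q_def)
      then show ?thesis using p_mem by (auto elim!: dvdE intro: M.mult_mem_right)
    qed
    \<comment> \<open>This difference is 1.\<close>
    ultimately have "of_nat q - of_nat m \<in> M" by (rule M.diff_mem[rotated])
    then show False using M.one_notin by (simp add: m(2))
  qed
  define X :: "int poly" where "X = [:0, 1:]"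
  have eval_X [simp]: "int_eval z X = z" by (simp add: X_def)
  have X_power_m: "X ^ m - 1 \<in> M"
    using I_if_root[of "X ^ m - 1"] \<open>I \<subseteq> M\<close> z_power by auto
  have X_order: "X ^ i - 1 \<notin> M" if "0 < i" "i < m" for i
  proof
    assume mem: "X ^ i - 1 \<in> M"
    \<comment> \<open>The geometric sum vanishes at \<open>z\<close>, yet each of its
      \<open>m\<close> terms is 1 modulo \<open>M\<close>; hence \<open>m\<close> would lie in
      \<open>M\<close>.\<close>
    have "(\<Sum>j<m. (X ^ i) ^ j) \<in> I"
    proof (rule I_if_root)
      have "(z ^ i) ^ m = 1"
        using z_power by (metis power_commutes power_mult mult.commute power_one)
      then have "(\<Sum>j<m. (z ^ i) ^ j) = 0"
        using z_order[OF that] by (simp add: sum_gp_strict)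
      then show "int_eval z (\<Sum>j<m. (X ^ i) ^ j) = 0" by simp
    qed
    then have "(\<Sum>j<m. (X ^ i) ^ j) \<in> M" using \<open>I \<subseteq> M\<close> by blast
    moreover have "(\<Sum>j<m. (X ^ i) ^ j - 1 ^ j) \<in> M"
      by (intro M.sum_mem M.power_cong_mem mem)
    ultimately have "(\<Sum>j<m. (X ^ i) ^ j) - (\<Sum>j<m. (X ^ i) ^ j - 1 ^ j) \<in> M"
      by (rule M.diff_mem)
    then show False
      using m_notin by (simp add: sum_subtractf)
  qed
  \<comment> \<open>\<open>X\<close> is a unit modulo \<open>M\<close>, since \<open>X ^ m\<close>
    is congruent to 1.\<close>
  have X_power_notin: "X ^ i \<notin> M" if "i < m" for i
  proof
    assume "X ^ i \<in> M"
    then have "X ^ i * X ^ (m - i) \<in> M" by (rule M.mult_mem_right)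
    then have "X ^ m \<in> M" using that by (simp flip: power_add)
    then show False
      using M.diff_mem[OF _ X_power_m, of "X ^ m"] M.one_notin by simp
  qed
  have X_power_inj: "i = j" if "i < m" "j < m" "X ^ i - X ^ j \<in> M" for i j
    using that
  proof (induction i j rule: linorder_wlog)
    case (le i j)
    show ?case
    proof (rule ccontr)
      assume "i \<noteq> j"
      then have ij: "0 < j - i" "j - i < m" using le by auto
      have "X ^ j = X ^ i * X ^ (j - i)"
        using le by (simp flip: power_add)
      then have "X ^ j - X ^ i = X ^ i * (X ^ (j - i) - 1)"
        by (simp add: algebra_simps)
      then have "X ^ i * (X ^ (j - i) - 1) \<in> M"
        using M.diff_mem_sym[OF le(4)] by simp
      then show False
        using M.prime_mem X_power_notin le(2) X_order[OF ij] by blast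
    qed
  next
    case (sym i j)
    then show ?case using M.diff_mem_sym by blast
  qed
  define T where "T = insert 0 ((\<lambda>i. X ^ i) ` {..<m})"
  have T_inj: "x = y" if "x \<in> T" "y \<in> T" "x - y \<in> M" for x y
    using that X_power_inj X_power_notin M.uminus_mem[of "x - y"] unfolding T_def by auto
  have "finite T" by (simp add: T_def)
  have "inj_on (\<lambda>i. X ^ i) {..<m}"
    by (rule inj_onI) (use X_power_inj M.zero_mem in auto)
  moreover have "0 \<notin> (\<lambda>i. X ^ i) ` {..<m}"
    unfolding image_iff using X_power_notin M.zero_mem by (metis lessThan_iff)
  ultimately have "card T = q"
    by (simp add: T_def card_image m(2))
  have add_power: "(f + g) ^ q - (f ^ q + g ^ q) \<in> M" for f g
    unfolding q_def by (rule M.add_power_prime_power_mem[OF assms(1) p_mem])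
  \<comment> \<open>The residues fixed by the \<open>q\<close>-th power form a subring; it contains
    the integers and \<open>X\<close>, hence everything.\<close>
  have add_closed: "(f + g) ^ q - (f + g) \<in> M" if "f ^ q - f \<in> M" "g ^ q - g \<in> M" for f g
    using M.diff_mem_trans[OF add_power M.add_cong_mem[OF that]] .
  have mult_closed: "(f * g) ^ q - f * g \<in> M" if "f ^ q - f \<in> M" "g ^ q - g \<in> M" for f g
    using M.mult_cong_mem[OF that] by (simp add: power_mult_distrib)
  \<comment> \<open>Additivity applied to \<open>f\<close> and \<open>- f\<close> avoids
    distinguishing the parity of \<open>q\<close>.\<close>
  have uminus_closed: "(- f) ^ q - (- f) \<in> M" if "f ^ q - f \<in> M" for f
  proof -
    have "- (f ^ q + (- f) ^ q) \<in> M"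
      using add_power[of f "- f"] by (simp add: m(2))
    from M.diff_mem[OF M.uminus_mem[OF this] that] show ?thesis by simp
  qed
  have of_nat_closed: "of_nat c ^ q - of_nat c \<in> M" for c
  proof (induction c)
    case 0
    then show ?case by (simp add: m(2) M.zero_mem)
  next
    case (Suc c)
    then show ?case
      using add_closed[of 1 "of_nat c"] M.zero_mem by simp
  qed
  have of_int_closed: "of_int c ^ q - of_int c \<in> M" for c
    using of_nat_closed uminus_closed[OF of_nat_closed] by (cases c rule: int_cases2) auto
  have X_closed: "X ^ q - X \<in> M"
    using M.mult_mem[OF X_power_m, of X] by (simp add: m(2) algebra_simps)
  have power_q: "f ^ q - f \<in> M" for f
  proof (induction f)
    case 0
    then show ?case by (simp add: m(2) M.zero_mem)
  next
    case (pCons c f)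
    have "pCons c f = of_int c + X * f"
      by (simp add: X_def of_int_poly)
    then show ?case
      using add_closed[OF of_int_closed mult_closed[OF X_closed pCons.IH]] by metis
  qed
  have "\<exists>t\<in>T. f - t \<in> M" for f
  proof (rule ccontr)
    assume *: "\<not> (\<exists>t\<in>T. f - t \<in> M)"
    then have f: "f \<notin> T" "\<And>t. t \<in> T \<Longrightarrow> f - t \<notin> M" "\<And>t. t \<in> T \<Longrightarrow> t - f \<notin> M"
      using M.zero_mem M.diff_mem_sym by auto
    \<comment> \<open>With \<open>f\<close> as a further residue, \<open>Y ^ q - Y\<close> would
      have \<open>q + 1\<close> roots, which forces its leading coefficient 1 into
      \<open>M\<close>.\<close>
    define P :: "int poly poly" where "P = monom 1 q - monom 1 1"
    have "coeff P q \<in> M"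
    proof (rule M.coeff_mem_if_many_roots)
      show "finite (insert f T)" using \<open>finite T\<close> by simp
      have "degree P \<le> q"
        unfolding P_def using \<open>q \<ge> 2\<close>
        by (intro degree_diff_le degree_monom_le order_trans[OF degree_monom_le]) auto
      then show "degree P < card (insert f T)"
        using \<open>finite T\<close> f(1) \<open>card T = q\<close> by simp
      show "poly P x \<in> M" for x
        using power_q[of x] by (simp add: P_def poly_monom)
      show "x = y" if "x \<in> insert f T" "y \<in> insert f T" "x - y \<in> M" for x y
        using that f T_inj by auto
    qed
    moreover have "coeff P q = 1"
      using \<open>q \<ge> 2\<close> by (simp add: P_def)
    ultimately show False using M.one_notin by simp
  qed
  then show ?thesis
    using \<open>proper_prime_ideal M\<close> \<open>finite T\<close> \<open>card T = q\<close> T_inj unfolding q_def by blast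
qed

section \<open>Polynomial codes\<close>

text \<open>The Reed--Solomon code of dimension \<open>r + 1\<close>: the word with index \<open>(s, a)\<close> lists the values of
  the polynomial with constant term \<open>a\<close> and remaining coefficients encoded by \<open>s\<close>.\<close>

lemma exists_polynomial_code:
  fixes q r k :: nat
  assumes "primepow q" "k \<le> q"
  shows "\<exists>w :: nat \<Rightarrow> nat \<Rightarrow> nat \<Rightarrow> nat.
           (\<forall>s<q ^ r. \<forall>a<q. \<forall>i<k. w s a i < q) \<and>
           (\<forall>s<q ^ r. \<forall>a<q. \<forall>b<q. \<forall>i<k. w s a i = w s b i \<longrightarrow> a = b) \<and>
           (\<forall>s<q ^ r. \<forall>t<q ^ r. \<forall>a<q. \<forall>b<q. (s, a) \<noteq> (t, b) \<longrightarrow>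
              card {i. i < k \<and> w s a i = w t b i} \<le> r)"
proof -
  obtain p n where "prime p" "n > 0" "q = p ^ n"
    using assms(1) unfolding primepow_def by blast
  then obtain M :: "int poly set" and T where "proper_prime_ideal M" "finite T" "card T = q"
    and T_inj: "\<And>x y. x \<in> T \<Longrightarrow> y \<in> T \<Longrightarrow> x - y \<in> M \<Longrightarrow> x = y"
    and T_surj: "\<And>f. \<exists>t\<in>T. f - t \<in> M"
    using exists_residue_field_of_prime_power_order[of p n] by metis
  interpret M: proper_prime_ideal M by fact
  obtain e where e: "bij_betw e {0..<q} T"
    using ex_bij_betw_nat_finite[OF \<open>finite T\<close>] \<open>card T = q\<close> by blast
  have e_T: "e i \<in> T" if "i < q" for i
    using e that by (auto simp: bij_betw_def)
  have e_inj: "i = j" if "i < q" "j < q" "e i - e j \<in> M" for i j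
  proof -
    have "e i = e j" using T_inj e_T that by blast
    then show ?thesis
      using e that by (auto simp: bij_betw_def dest: inj_onD)
  qed
  have "card ({..<r} \<rightarrow>\<^sub>E T) = q ^ r"
    by (simp add: card_PiE \<open>card T = q\<close>)
  moreover have "finite ({..<r} \<rightarrow>\<^sub>E T)"
    by (simp add: finite_PiE \<open>finite T\<close>)
  ultimately obtain h where h: "bij_betw h {0..<q ^ r} ({..<r} \<rightarrow>\<^sub>E T)"
    using ex_bij_betw_nat_finite by metis
  have h_mem: "h s \<in> {..<r} \<rightarrow>\<^sub>E T" if "s < q ^ r" for s
    using h that by (auto simp: bij_betw_def)
  \<comment> \<open>Exponents start at 1: the constant term is reserved for \<open>a\<close>, so
    that words with the same \<open>s\<close> differ by a constant.\<close>
  define P where "P s = (\<Sum>l<r. monom (h s l) (Suc l))" for s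
  have coeff_P_0: "coeff (P s) 0 = 0" for s
    by (simp add: P_def coeff_sum)
  have coeff_P_Suc: "coeff (P s) (Suc l) = h s l" if "l < r" for s l
    using that by (simp add: P_def coeff_sum)
  have degree_P: "degree (P s) \<le> r" for s
    unfolding P_def by (intro degree_sum_le) (auto intro: order_trans[OF degree_monom_le])
  \<comment> \<open>The letter is the index of the representative congruent to the value of the
    polynomial at the point \<open>e i\<close>.\<close>
  have "\<forall>s a i. \<exists>j. j < q \<and> (e a + poly (P s) (e i)) - e j \<in> M"
  proof (intro allI)
    fix s a i
    obtain t where "t \<in> T" "(e a + poly (P s) (e i)) - t \<in> M"
      using T_surj by blast
    moreover then obtain j where "j < q" "t = e j"
      using e by (auto simp: bij_betw_def)
    ultimately show "\<exists>j. j < q \<and> (e a + poly (P s) (e i)) - e j \<in> M" by blast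
  qed
  then obtain w where w_less: "\<And>s a i. w s a i < q"
    and w_mem: "\<And>s a i. (e a + poly (P s) (e i)) - e (w s a i) \<in> M"
    by metis
  have agree: "(e a + poly (P s) (e i)) - (e b + poly (P t) (e i)) \<in> M"
    if "w s a i = w t b i" for s a t b i
    using M.diff_mem_trans[OF w_mem[of a s i] M.diff_mem_sym[OF w_mem[of b t i, folded that]]] .
  have same: "a = b" if "a < q" "b < q" "w s a i = w s b i" for s a b i
    using agree[OF that(3)] by (intro e_inj that) simp
  have few: "card {i. i < k \<and> w s a i = w t b i} \<le> r"
    if "s < q ^ r" "t < q ^ r" "a < q" "b < q" "(s, a) \<noteq> (t, b)" for s t a b
  proof (rule ccontr)
    define S where "S = {i. i < k \<and> w s a i = w t b i}"
    assume "\<not> card {i. i < k \<and> w s a i = w t b i} \<le> r"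
    then have S: "card S > r" by (simp add: S_def)
    have S_less: "i < q" if "i \<in> S" for i
      using that assms(2) by (simp add: S_def)
    have "inj_on e S"
      by (rule inj_onI) (use e_inj S_less M.zero_mem in auto)
    \<comment> \<open>If the words agree in more than \<open>r\<close> positions, this difference
      vanishes modulo \<open>M\<close> at more than \<open>r\<close> points. Its coefficient 0 then
      gives \<open>a = b\<close>, the others \<open>s = t\<close>.\<close>
    define D where "D = [:e a - e b:] + P s - P t"
    have D: "coeff D j \<in> M" for j
    proof (rule M.coeff_mem_if_many_roots)
      show "finite (e ` S)" by (simp add: S_def)
      have "degree D \<le> r"
        unfolding D_def by (intro degree_diff_le degree_add_le degree_P) simp
      then show "degree D < card (e ` S)"
        using S by (simp add: card_image[OF \<open>inj_on e S\<close>])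
      show "poly D x \<in> M" if "x \<in> e ` S" for x
        using that agree by (auto simp: S_def D_def algebra_simps)
      show "x = y" if "x \<in> e ` S" "y \<in> e ` S" "x - y \<in> M" for x y
        using that T_inj e_T S_less by blast
    qed
    have "a = b"
      using D[of 0] that by (intro e_inj) (auto simp: D_def coeff_P_0)
    moreover have "h s = h t"
    proof (rule PiE_ext[OF h_mem[OF that(1)] h_mem[OF that(2)]])
      fix l assume "l \<in> {..<r}"
      then have "h s l - h t l \<in> M" "h s l \<in> T" "h t l \<in> T"
        using D[of "Suc l"] h_mem[OF that(1)] h_mem[OF that(2)]
        by (auto simp: D_def coeff_P_Suc)
      then show "h s l = h t l" using T_inj by blast
    qed
    then have "s = t"
      using h that by (auto simp: bij_betw_def dest: inj_onD)
    ultimately show False using that by simp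
  qed
  show ?thesis
    using w_less same few by (intro exI[of _ w]) blast
qed

section \<open>The frame of a code\<close>

definition fourier_entry :: "nat \<Rightarrow> nat \<Rightarrow> nat \<Rightarrow> complex" where
  "fourier_entry k i j = cis (2 * pi * real (i * j) / real k) / complex_of_real (sqrt (real k))"

lemma cmod_fourier_entry: "cmod (fourier_entry k i j) = 1 / sqrt (real k)"
  by (simp add: fourier_entry_def norm_divide)

text \<open>The sum is geometric in a \<open>k\<close>-th root of unity that equals 1 only for
  \<open>j = j'\<close>.\<close>

lemma sum_fourier_entry:
  assumes "j < k" "j' < k"
  shows "(\<Sum>i<k. fourier_entry k i j * cnj (fourier_entry k i j')) = (if j = j' then 1 else 0)"
proof -
  define \<omega> where "\<omega> = cis (2 * pi * real j / real k) * cnj (cis (2 * pi * real j' / real k))"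
  have k: "k > 0" using assms by simp
  have "fourier_entry k i j * cnj (fourier_entry k i j') = \<omega> ^ i / of_nat k" for i
  proof -
    have "cis (2 * pi * real (i * l) / real k) = cis (2 * pi * real l / real k) ^ i" for l
      by (simp add: DeMoivre mult_ac)
    moreover have "complex_of_real (sqrt (real k)) * complex_of_real (sqrt (real k)) = of_nat k"
      by (simp flip: of_real_mult)
    ultimately show ?thesis
      by (simp add: fourier_entry_def \<omega>_def power_mult_distrib)
  qed
  then have sum_eq: "(\<Sum>i<k. fourier_entry k i j * cnj (fourier_entry k i j')) 
      = (\<Sum>i<k. \<omega> ^ i) / of_nat k"
    by (simp add: sum_divide_distrib)
  have "\<omega> ^ k = 1"
    using k by (simp add: \<omega>_def power_mult_distrib DeMoivre mult.commute[of "real k"] flip: complex_cnj_power)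
  moreover have "\<omega> = 1 \<longleftrightarrow> j = j'"
  proof
    assume "\<omega> = 1"
    moreover have "cnj c * c = 1" if "cmod c = 1" for c
      using that complex_norm_square[of c] by (simp add: mult.commute)
    ultimately have "cis (2 * pi * real j / real k) = cis (2 * pi * real j' / real k)"
      unfolding \<omega>_def by (metis mult.assoc mult.right_neutral mult_1 norm_cis)
    then show "j = j'"
      using bij_betw_imp_inj_on[OF bij_betw_roots_unity[OF k]] assms
      by (elim inj_onD) auto
  qed (simp add: \<omega>_def cis_cnj cis_mult)
  ultimately show ?thesis
    unfolding sum_eq using k by (simp add: sum_gp_strict)
qed

text \<open>Identifies column \<open>c\<close> of the concatenated bases as column
  \<open>c mod n\<close> of block \<open>c div n\<close>.\<close>

lemma concat_map_blocks:
  assumes "n > 0"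
  shows "concat (map (\<lambda>s. map (g s) [0..<n]) [0..<Q]) = map (\<lambda>c. g (c div n) (c mod n)) [0..<n * Q]"
proof (induction Q)
  case 0
  then show ?case by simp
next
  case (Suc Q)
  have "map (g Q) [0..<n] = map (\<lambda>c. g (c div n) (c mod n)) [n * Q..<n * Q + n]"
    using assms by (intro nth_equalityI) auto
  then show ?case
    using Suc upt_add_eq_append[of 0 "n * Q" n] by (simp add: add.commute)
qed

lemma sum_lessThan_mult:
  fixes f :: "nat \<Rightarrow> 'a::comm_monoid_add"
  assumes "q > 0"
  shows "(\<Sum>c<q * k. f c) = (\<Sum>i<k. \<Sum>y<q. f (i * q + y))"
proof (induction k)
  case 0
  then show ?case by simp
next
  case (Suc k)
  have "{..<q * Suc k} = {..<q * k} \<union> {q * k..<q * k + q}"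
    by auto
  then have "(\<Sum>c<q * Suc k. f c) = (\<Sum>c<q * k. f c) + (\<Sum>c=q * k..<q * k + q. f c)"
    by (simp add: sum.union_disjoint ivl_disj_int)
  also have "(\<Sum>c=q * k..<q * k + q. f c) = (\<Sum>y<q. f (k * q + y))"
    using sum.shift_bounds_nat_ivl[of f 0 "q * k" q]
    by (simp add: lessThan_atLeast0 add.commute mult.commute)
  finally show ?case using Suc by simp
qed

text \<open>The squared moduli in row 0 sum to 1, so the largest is at least their average. This
  converts a coherence bound \<open>r / k\<close> into one in terms of
  \<open>\<alpha>\<close>.\<close>

lemma unitary_mat_max_entry:
  assumes "unitary_mat k U" "k > 0"
  shows "1 / real k \<le> (Max {cmod (U $$ (i, j)) | i j. i < k \<and> j < k})\<^sup>2"
proof -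
  define \<alpha> where "\<alpha> = Max {cmod (U $$ (i, j)) | i j. i < k \<and> j < k}"
  have U: "U \<in> carrier_mat k k" "U * mat_adjoint U = 1\<^sub>m k"
    using assms(1) by (auto simp: unitary_mat_def)
  have "{cmod (U $$ (i, j)) | i j. i < k \<and> j < k}
      = (\<lambda>(i, j). cmod (U $$ (i, j))) ` ({..<k} \<times> {..<k})"
    by auto
  then have "finite {cmod (U $$ (i, j)) | i j. i < k \<and> j < k}" by simp
  then have le: "cmod (U $$ (i, j)) \<le> \<alpha>" if "i < k" "j < k" for i j
    unfolding \<alpha>_def using that by (intro Max_ge) auto
  have "1 = (U * mat_adjoint U) $$ (0, 0)"
    using U(2) assms(2) by simp
  also have "\<dots> = (\<Sum>j<k. U $$ (0, j) * cnj (U $$ (0, j)))"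
    using U(1) assms(2)
    by (simp add: mat_adjoint_def scalar_prod_def lessThan_atLeast0 mat_of_rows_def)
  also have "\<dots> = of_real (\<Sum>j<k. (cmod (U $$ (0, j)))\<^sup>2)"
    by (simp only: of_real_sum complex_norm_square)
  finally have "1 = (\<Sum>j<k. (cmod (U $$ (0, j)))\<^sup>2)"
    by (metis of_real_eq_1_iff)
  also have "\<dots> \<le> (\<Sum>j<k. \<alpha>\<^sup>2)"
    using le assms(2) by (intro sum_mono power_mono) auto
  finally show ?thesis
    using assms(2) by (simp add: \<alpha>_def divide_le_eq mult.commute)
qed

section \<open>The frame: inner products, orthonormality, coherence, density\<close>

text \<open>Row \<open>i * q + y\<close> stands for the pair of position \<open>i < k\<close> and letter \<open>y < q\<close>; column
  \<open>a * k + j\<close> of block \<open>s\<close> is the \<open>j\<close>-th Fourier vector, placed on the graph of the word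
  \<open>w s a\<close>.\<close>

locale block_code =
  fixes w :: "nat \<Rightarrow> nat \<Rightarrow> nat \<Rightarrow> nat" and Q q k r n :: nat
  assumes pos: "Q > 0" "q > 1" "k > 0"
    and n_def: "n = q * k"
    and w_less: "s < Q \<Longrightarrow> a < q \<Longrightarrow> i < k \<Longrightarrow> w s a i < q"
    and w_inj: "s < Q \<Longrightarrow> a < q \<Longrightarrow> b < q \<Longrightarrow> i < k \<Longrightarrow> w s a i = w s b i \<Longrightarrow> a = b"
    and w_agree: "s < Q \<Longrightarrow> t < Q \<Longrightarrow> a < q \<Longrightarrow> b < q \<Longrightarrow> (s, a) \<noteq> (t, b) \<Longrightarrow>
                  card {i. i < k \<and> w s a i = w t b i} \<le> r"
begin

definition entry :: "nat \<Rightarrow> nat \<Rightarrow> nat \<Rightarrow> complex" where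
  "entry s R C = (if w s (C div k) (R div q) = R mod q
                  then fourier_entry k (R div q) (C mod k) else 0)"

definition block :: "nat \<Rightarrow> complex mat" where
  "block s = mat n n (\<lambda>(R, C). entry s R C)"

definition frame :: "complex mat" where
  "frame = mat n (n * Q) (\<lambda>(R, C). entry (C div n) R (C mod n))"

lemma n_pos: "n > 0"
  using pos by (simp add: n_def)

lemma column_index_less:
  assumes "C < n"
  shows "C div k < q" "C mod k < k"
  using assms pos by (auto simp: n_def less_mult_imp_div_less)

lemma column_block_less:
  assumes "C < n * Q"
  shows "C div n < Q" "C mod n < n"
  using assms n_pos by (auto simp: less_mult_imp_div_less mult.commute)

text \<open>At each position a column is supported on a single letter, so only positions where the
  two words agree contribute.\<close>

lemma entry_inner:
  assumes "s < Q" "t < Q" "C < n" "D < n"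
  shows "(\<Sum>R<n. entry s R C * cnj (entry t R D)) =
    (\<Sum>i | i < k \<and> w s (C div k) i = w t (D div k) i.
       fourier_entry k i (C mod k) * cnj (fourier_entry k i (D mod k)))"
proof -
  let ?a = "w s (C div k)" and ?b = "w t (D div k)"
  let ?u = "\<lambda>i. fourier_entry k i (C mod k) * cnj (fourier_entry k i (D mod k))"
  have "(\<Sum>R<n. entry s R C * cnj (entry t R D))
      = (\<Sum>i<k. \<Sum>y<q. entry s (i * q + y) C * cnj (entry t (i * q + y) D))"
    unfolding n_def using pos by (intro sum_lessThan_mult) simp
  also have "\<dots> = (\<Sum>i<k. \<Sum>y<q. if ?a i = y then if ?a i = ?b i then ?u i else 0 else 0)"
    by (intro sum.cong) (auto simp: entry_def)
  also have "\<dots> = (\<Sum>i<k. if ?a i = ?b i then ?u i else 0)"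
    using w_less[OF assms(1) column_index_less(1)[OF assms(3)]]
    by (intro sum.cong) auto
  also have "\<dots> = (\<Sum>i | i < k \<and> ?a i = ?b i. ?u i)"
    by (simp add: sum.inter_filter[symmetric])
  finally show ?thesis .
qed

text \<open>For equal words the sum runs over all positions and Fourier orthogonality applies;
  different words of one block agree nowhere, so the supports are disjoint.\<close>

lemma entry_orthonormal:
  assumes "s < Q" "C < n" "D < n"
  shows "(\<Sum>R<n. entry s R C * cnj (entry s R D)) = (if C = D then 1 else 0)"
proof (cases "C div k = D div k")
  case True
  then have "C = D \<longleftrightarrow> C mod k = D mod k"
    by (metis div_mult_mod_eq)
  with True show ?thesis
    unfolding entry_inner[OF assms(1,1,2,3)]
    using sum_fourier_entry[OF column_index_less(2)[OF assms(2)] column_index_less(2)[OF assms(3)]]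
    by (simp add: lessThan_def)
next
  case False
  have empty: "{i. i < k \<and> w s (C div k) i = w s (D div k) i} = {}"
    using False w_inj assms column_index_less by blast
  have "C \<noteq> D" using False by auto
  then show ?thesis
    unfolding entry_inner[OF assms(1,1,2,3)] empty by simp
qed

text \<open>For different words at most \<open>r\<close> terms survive, each of modulus
  \<open>1 / k\<close>; for the same word the columns are orthogonal.\<close>

lemma entry_inner_bound:
  assumes "s < Q" "t < Q" "C < n" "D < n" "(s, C) \<noteq> (t, D)"
  shows "cmod (\<Sum>R<n. entry s R C * cnj (entry t R D)) \<le> real r / real k"
proof (cases "(s, C div k) = (t, D div k)")
  case True
  then show ?thesis
    using assms entry_orthonormal[OF assms(1,3,4)] by auto
next
  case False
  let ?S = "{i. i < k \<and> w s (C div k) i = w t (D div k) i}"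
  have "cmod (\<Sum>R<n. entry s R C * cnj (entry t R D)) \<le>
      (\<Sum>i\<in>?S. cmod (fourier_entry k i (C mod k) * cnj (fourier_entry k i (D mod k))))"
    unfolding entry_inner[OF assms(1-4)] by (rule norm_sum)
  also have "\<dots> = real (card ?S) / real k"
    by (simp add: norm_mult cmod_fourier_entry)
  also have "\<dots> \<le> real r / real k"
    using w_agree[OF assms(1,2) column_index_less(1)[OF assms(3)] column_index_less(1)[OF assms(4)] False]
    by (simp add: divide_right_mono)
  finally show ?thesis .
qed

lemma unitary_block:
  assumes "s < Q"
  shows "unitary_mat n (block s)"
proof -
  have carrier: "block s \<in> carrier_mat n n" "mat_adjoint (block s) \<in> carrier_mat n n"
    by (auto simp: block_def mat_adjoint_def)
  have "mat_adjoint (block s) * block s = 1\<^sub>m n"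
  proof (rule eq_matI)
    fix C D assume "C < dim_row (1\<^sub>m n :: complex mat)" "D < dim_col (1\<^sub>m n :: complex mat)"
    then have CD: "C < n" "D < n" by auto
    have "(mat_adjoint (block s) * block s) $$ (C, D) = (\<Sum>R<n. entry s R D * cnj (entry s R C))"
      using CD
      by (simp add: block_def mat_adjoint_def mat_of_rows_def scalar_prod_def lessThan_atLeast0 mult.commute)
    also have "\<dots> = 1\<^sub>m n $$ (C, D)"
      using CD entry_orthonormal[OF assms CD(2,1)] by auto
    finally show "(mat_adjoint (block s) * block s) $$ (C, D) = 1\<^sub>m n $$ (C, D)" .
  qed (use carrier in auto)
  \<comment> \<open>For square matrices a left inverse is also a right inverse.\<close>
  then show ?thesis
    using carrier mat_mult_left_right_inverse[OF carrier(2,1)] by (simp add: unitary_mat_def)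
qed

lemma union_of_orthonormal_bases_frame: "union_of_orthonormal_bases n Q frame"
proof -
  have "cols frame = map (\<lambda>C. vec n (\<lambda>R. entry (C div n) R (C mod n))) [0..<n * Q]"
    by (intro nth_equalityI) (auto simp: frame_def)
  also have "\<dots> = concat (map (\<lambda>s. map (\<lambda>C. vec n (\<lambda>R. entry s R C)) [0..<n]) [0..<Q])"
    by (rule concat_map_blocks[OF n_pos, symmetric])
  also have "(\<lambda>s. map (\<lambda>C. vec n (\<lambda>R. entry s R C)) [0..<n]) = (\<lambda>s. cols (block s))"
    by (intro ext nth_equalityI) (auto simp: block_def)
  finally have "frame = mat_of_cols n (concat (map cols (map block [0..<Q])))"
    using mat_of_cols_cols[of frame] by (simp add: frame_def o_def)
  moreover have "frame \<in> carrier_mat n (n * Q)" by (simp add: frame_def)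
  ultimately show ?thesis
    unfolding union_of_orthonormal_bases_def using unitary_block
    by (intro conjI exI[of _ "map block [0..<Q]"]) auto
qed

lemma frame_inner:
  assumes "C < n * Q" "D < n * Q"
  shows "col frame C \<bullet>c col frame D
    = (\<Sum>R<n. entry (C div n) R (C mod n) * cnj (entry (D div n) R (D mod n)))"
  using assms by (simp add: frame_def scalar_prod_def lessThan_atLeast0)

lemma l2_norm_col_frame:
  assumes "C < n * Q"
  shows "l2_norm_vec (col frame C) = 1"
proof -
  have "complex_of_real (\<Sum>R<n. (cmod (entry (C div n) R (C mod n)))\<^sup>2)
      = (\<Sum>R<n. entry (C div n) R (C mod n) * cnj (entry (C div n) R (C mod n)))"
    by (simp only: of_real_sum complex_norm_square)
  also have "\<dots> = 1"
    using column_block_less[OF assms] by (simp add: entry_orthonormal)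
  finally have "(\<Sum>R<n. (cmod (entry (C div n) R (C mod n)))\<^sup>2) = 1"
    by (simp only: of_real_eq_1_iff)
  then show ?thesis
    using assms by (simp add: l2_norm_vec_def frame_def)
qed

lemma coherence_frame: "coherence frame \<le> real r / real k"
proof -
  define f where "f = (\<lambda>(C, D). cmod (col frame C \<bullet>c col frame D)
    / (l2_norm_vec (col frame C) * l2_norm_vec (col frame D)))"
  define S where "S = {(C, D). C < n * Q \<and> D < n * Q \<and> C \<noteq> D}"
  have "dim_col frame = n * Q" by (simp add: frame_def)
  then have "coherence frame = Max (f ` S)"
    unfolding coherence_def by (intro arg_cong[of _ _ Max]) (auto simp: f_def S_def)
  moreover have "finite S"
    by (rule finite_subset[of _ "{..<n * Q} \<times> {..<n * Q}"]) (auto simp: S_def)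
  \<comment> \<open>The maximum must range over a nonempty set; two columns exist because
    \<open>q > 1\<close>.\<close>
  moreover have "(0, 1) \<in> S"
  proof -
    have "q * 1 \<le> q * (k * Q)"
      using pos by (intro mult_le_mono2) simp
    then have "1 < n * Q"
      using pos(2) unfolding n_def mult.assoc by linarith
    then show ?thesis
      using n_pos pos(1) by (simp add: S_def)
  qed
  moreover have "f x \<le> real r / real k" if x_S: "x \<in> S" for x
  proof -
    obtain C D where x: "x = (C, D)" and CD: "C < n * Q" "D < n * Q" "C \<noteq> D"
      using x_S by (auto simp: S_def)
    have "(C div n, C mod n) \<noteq> (D div n, D mod n)"
      using CD(3) by (metis div_mult_mod_eq prod.inject)
    then have "cmod (col frame C \<bullet>c col frame D) \<le> real r / real k"
      unfolding frame_inner[OF CD(1,2)]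
      by (intro entry_inner_bound column_block_less CD)
    then show ?thesis
      by (simp add: x f_def l2_norm_col_frame CD)
  qed
  ultimately show ?thesis
    by (subst \<open>coherence frame = Max (f ` S)\<close>, intro Max.boundedI) auto
qed

text \<open>Fourier entries never vanish, so each column has exactly one nonzero entry per position:
  \<open>k\<close> among \<open>n = q * k\<close>.\<close>

lemma matrix_density_frame: "matrix_density frame = 1 / real q"
proof -
  \<comment> \<open>Sends a position and a column to the place of the corresponding nonzero
    entry.\<close>
  define f where "f = (\<lambda>(i, C). (i * q + w (C div n) (C mod n div k) i, C))"
  have less: "w (C div n) (C mod n div k) i < q" if "i < k" "C < n * Q" for i C
    using that by (intro w_less column_index_less column_block_less)
  have "{(R, C). R < n \<and> C < n * Q \<and> frame $$ (R, C) \<noteq> 0} = f ` ({..<k} \<times> {..<n * Q})"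
    (is "?N = ?I")
  proof (intro equalityI subsetI)
    fix x assume "x \<in> ?N"
    then obtain R C where x: "x = (R, C)" and RC: "R < n" "C < n * Q" "frame $$ (R, C) \<noteq> 0"
      by blast
    then have "w (C div n) (C mod n div k) (R div q) = R mod q"
      by (auto simp: frame_def entry_def split: if_splits)
    then have "x = f (R div q, C)"
      by (simp add: x f_def)
    moreover have "R div q < k"
      using RC(1) by (simp add: n_def less_mult_imp_div_less mult.commute)
    ultimately show "x \<in> ?I" using RC(2) by blast
  next
    fix x assume "x \<in> ?I"
    then obtain i C where x: "x = f (i, C)" and iC: "i < k" "C < n * Q"
      by blast
    have "i * q + w (C div n) (C mod n div k) i < Suc i * q"
      using less[OF iC] by simp
    also have "\<dots> \<le> n"
      using iC(1) unfolding n_def mult.commute[of q] by (intro mult_le_mono1) simp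
    finally have "i * q + w (C div n) (C mod n div k) i < n" .
    moreover have "fourier_entry k i (C mod n mod k) \<noteq> 0"
      using cmod_fourier_entry[of k i "C mod n mod k"] pos(3) by auto
    ultimately show "x \<in> ?N"
      using iC less[OF iC] by (simp add: x f_def frame_def entry_def)
  qed
  moreover have "inj_on f ({..<k} \<times> {..<n * Q})"
  proof (rule inj_onI)
    fix x y
    assume "x \<in> {..<k} \<times> {..<n * Q}" "y \<in> {..<k} \<times> {..<n * Q}" and f_eq: "f x = f y"
    then obtain i C j D where xy: "x = (i, C)" "y = (j, D)"
      and *: "i < k" "C < n * Q" "j < k" "D < n * Q"
      by blast
    from f_eq have "C = D" and eq: "i * q + w (C div n) (C mod n div k) i
        = j * q + w (D div n) (D mod n div k) j"
      unfolding f_def xy by auto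
    \<comment> \<open>The letter is below \<open>q\<close>, so division by \<open>q\<close> recovers
      the position.\<close>
    have "(i * q + w (C div n) (C mod n div k) i) div q = i"
      using less[of i C] * by simp
    moreover have "(j * q + w (D div n) (D mod n div k) j) div q = j"
      using less[of j D] * by simp
    ultimately show "x = y"
      unfolding xy using \<open>C = D\<close> eq by metis
  qed
  ultimately have "card {(R, C). R < n \<and> C < n * Q \<and> frame $$ (R, C) \<noteq> 0} = k * (n * Q)"
    by (simp add: card_image)
  moreover have "dim_row frame = n" "dim_col frame = n * Q"
    by (simp_all add: frame_def)
  ultimately have "matrix_density frame = real (k * (n * Q)) / real (n * (n * Q))"
    by (simp only: matrix_density_def)
  also have "\<dots> = 1 / real q"
    using pos by (simp add: n_def)
  finally show ?thesis .
qed

end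

theorem mainTheorem2:
  fixes p r k :: nat and U :: "complex mat" and \<alpha> :: real
  assumes "prime p \<or> primepow p"
    and "0 < r" and "r < k" and "k \<le> p"
    and "unitary_mat k U"
    and "\<alpha> = Max {cmod (U $$ (i, j)) | i j. i < k \<and> j < k}"
    and "real r * \<alpha>\<^sup>2 < 1"
  shows "\<exists>\<Phi> :: complex mat.
           \<Phi> \<in> carrier_mat (p * k) (p * k * p ^ r) \<and>
           union_of_orthonormal_bases (p * k) (p ^ r) \<Phi> \<and>
           coherence \<Phi> \<le> real r * \<alpha>\<^sup>2 \<and>
           matrix_density \<Phi> = 1 / real p"
proof -
  have "primepow p"
    using assms(1) primepow_prime by blast
  then have p: "p > 1"
    by (rule primepow_gt_Suc_0[unfolded One_nat_def[symmetric]])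
  have k: "k > 0" using assms(3) by simp
  obtain w where w:
    "\<forall>s<p ^ r. \<forall>a<p. \<forall>i<k. w s a i < p"
    "\<forall>s<p ^ r. \<forall>a<p. \<forall>b<p. \<forall>i<k. w s a i = w s b i \<longrightarrow> a = b"
    "\<forall>s<p ^ r. \<forall>t<p ^ r. \<forall>a<p. \<forall>b<p. (s, a) \<noteq> (t, b) \<longrightarrow>
       card {i. i < k \<and> w s a i = w t b i} \<le> r"
    using exists_polynomial_code[OF \<open>primepow p\<close> assms(4), of r]
    by (elim exE conjE) (rule that)
  \<comment> \<open>One block for each of the \<open>p ^ r\<close> choices of nonconstant
    coefficients; within a block the constant term varies.\<close>
  interpret block_code w "p ^ r" p k r "p * k"
  proof
    show "p ^ r > 0" "p > 1" "k > 0" "p * k = p * k" using p k by simp_all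
    show "w s a i < p" if "s < p ^ r" "a < p" "i < k" for s a i
      using w(1) that by blast
    show "a = b" if "s < p ^ r" "a < p" "b < p" "i < k" "w s a i = w s b i" for s a b i
      using w(2) that by blast
    show "card {i. i < k \<and> w s a i = w t b i} \<le> r"
      if "s < p ^ r" "t < p ^ r" "a < p" "b < p" "(s, a) \<noteq> (t, b)" for s t a b
      using w(3) that by blast
  qed
  have "1 / real k \<le> \<alpha>\<^sup>2"
    unfolding assms(6) by (rule unitary_mat_max_entry[OF assms(5) k])
  then have "real r / real k \<le> real r * \<alpha>\<^sup>2"
    using mult_left_mono[of "1 / real k" "\<alpha>\<^sup>2" "real r"] by simp
  then have "coherence frame \<le> real r * \<alpha>\<^sup>2"
    using coherence_frame by linarith
  moreover have "frame \<in> carrier_mat (p * k) (p * k * p ^ r)"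
    by (simp add: frame_def)
  ultimately show ?thesis
    using union_of_orthonormal_bases_frame matrix_density_frame by blast
qed

end
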